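(* Let $J\colon\mathbb{R}^2\to\mathbb{R}^2$ be the rotation $J(u,v)=(-v,u)$, let $A=aI+\gamma J$ with $a\ge0$, $\gamma\in\mathbb{R}$, and let $B=J$. Define the cubic $$P(\lambda)=A_3\lambda^3+A_2\lambda^2+A_1\lambda+A_0,$$ where $$A_3=a^4+2a^2\gamma^2-6a^2+\gamma^4-6\gamma^2-8\gamma-3,\quad A_2=4a^3+4a\gamma^2-4a,\quad A_1=5a^2+\gamma^2+2\gamma+1,\quad A_0=2a,$$ and let $\lambda^\star(a,\gamma)$ be the smallest positive root of $P$, with $\lambda^\star(a,\gamma)=+\infty$ if none exists (at the single point $(a,\gamma)=(0,-1)$ the cubic vanishes identically and $\lambda^\star=+\infty$). The iterates of the forward-reflected-backward method $$x_{k+1}=(I+\lambda A)^{-1}\bigl(x_k-2\lambda B(x_k)+\lambda B(x_{k-1})\bigr)$$ converge to an element of $\operatorname{zer}(A+B)$ for every $\lambda\in(0,\lambda^\star(a,\gamma))$ and diverge for every $\lambda>\lambda^\star(a,\gamma)$. Here $\operatorname{zer}(A+B)=\{0\}$ except at $(a,\gamma)=(0,-1)$, where $A+B\equiv0$ and $\operatorname{zer}(A+B)=\mathbb{R}^2$: there $r=1$ is a simple root of the characteristic equation for every $\lambda>0$, with the second root of modulus $\lambda/\sqrt{1+\lambda^2}<1$, so the iterates converge to $\operatorname{zer}(A+B)$ for every $\lambda>0$. Moreover $$\min_{a\ge0,\ \gamma\in\mathbb{R}}\lambda^\star(a,\gamma)=\lambda^\star(0,1)=\tfrac12,$$ so the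 matched skew $(a,\gamma)=(0,1)$ is the global worst case of the entire family, and the symmetric part $a>0$ cannot lower the global threshold.
   Context: $\operatorname{zer}(A+B)=\{x\in\mathbb{R}^2: Ax+Bx=0\}$. The iteration is started from initial points $x_0,x_{-1}\in\mathbb{R}^2$ and run with a fixed step size $\lambda>0$. Identifying $\mathbb{R}^2$ with $\mathbb{C}$ so that $J$ is multiplication by $i$, the iteration becomes a scalar complex two-step linear recursion whose characteristic equation is $(1+\lambda(a+i\gamma))\,r^2=(1-2i\lambda)\,r+i\lambda$.
   Formalization: For step sizes above the threshold, divergence (norms tending to infinity) is claimed for all initial pairs outside some proper linear subspace, not for every initial pair, since zero initial points give the zero sequence, which converges. *)

theory Defs
  imports
    "HOL-Analysis.Analysis"
    "HOL-Computational_Algebra.Polynomial"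
begin

definition rotJ :: "real ^ 2 \<Rightarrow> real ^ 2" where
  "rotJ x = vector [- (x $ 2), x $ 1]"

definition opA :: "real \<Rightarrow> real \<Rightarrow> real ^ 2 \<Rightarrow> real ^ 2" where
  "opA a \<gamma> x = a *\<^sub>R x + \<gamma> *\<^sub>R rotJ x"

definition zer_sum :: "('a::real_vector \<Rightarrow> 'a) \<Rightarrow> ('a \<Rightarrow> 'a) \<Rightarrow> 'a set" where
  "zer_sum A B = {x. A x + B x = 0}"

text \<open>The total inverse \<open>inv\<close> is the genuine inverse only where \<open>I + lam A\<close> is bijective;
  for \<open>A = opA a \<gamma>\<close> with \<open>a \<ge> 0\<close> and \<open>lam > 0\<close> it is, the determinant being
  \<open>(1 + lam a)^2 + (lam \<gamma>)^2 > 0\<close>.\<close>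

definition resolvent :: "('a::real_vector \<Rightarrow> 'a) \<Rightarrow> real \<Rightarrow> 'a \<Rightarrow> 'a" where
  "resolvent A lam = inv (\<lambda>x. x + lam *\<^sub>R A x)"

text \<open>Forward-reflected-backward iterates. The index is shifted by one so that it is a natural
  number: \<open>frb A B lam xm1 x0 n\<close> is the iterate \<open>x\<^bsub>n-1\<^esub>\<close>, where \<open>xm1\<close> is the
  initial point with index \<open>-1\<close>.\<close>

fun frb :: "('a::real_vector \<Rightarrow> 'a) \<Rightarrow> ('a \<Rightarrow> 'a) \<Rightarrow> real \<Rightarrow> 'a \<Rightarrow> 'a \<Rightarrow> nat \<Rightarrow> 'a" where
  "frb A B lam xm1 x0 0 = xm1"
| "frb A B lam xm1 x0 (Suc 0) = x0"
| "frb A B lam xm1 x0 (Suc (Suc n)) =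
     resolvent A lam
       (frb A B lam xm1 x0 (Suc n)
        - (2 * lam) *\<^sub>R B (frb A B lam xm1 x0 (Suc n))
        + lam *\<^sub>R B (frb A B lam xm1 x0 n))"

text \<open>With the identification \<open>(u, v) = u + \<i> v\<close>, under which \<open>rotJ\<close> is multiplication by \<open>\<i>\<close>,
  the iteration for \<open>opA a \<gamma>\<close> and \<open>rotJ\<close> reads
  \<open>(1 + lam (a + \<i> \<gamma>)) z\<^bsub>k+1\<^esub> = (1 - 2 \<i> lam) z\<^bsub>k\<^esub> + \<i> lam z\<^bsub>k-1\<^esub>\<close>;
  this is its characteristic polynomial.\<close>

definition frb_charpoly :: "real \<Rightarrow> real \<Rightarrow> real \<Rightarrow> complex poly" where
  "frb_charpoly a \<gamma> lam =
     [: - (\<i> * of_real lam), - (1 - 2 * \<i> * of_real lam),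
        1 + of_real lam * (of_real a + \<i> * of_real \<gamma>) :]"

definition frb_cubic :: "real \<Rightarrow> real \<Rightarrow> real poly" where
  "frb_cubic a \<gamma> =
     [: 2 * a,
        5 * a^2 + \<gamma>^2 + 2 * \<gamma> + 1,
        4 * a^3 + 4 * a * \<gamma>^2 - 4 * a,
        a^4 + 2 * a^2 * \<gamma>^2 - 6 * a^2 + \<gamma>^4 - 6 * \<gamma>^2 - 8 * \<gamma> - 3 :]"

text \<open>When the cubic is not the zero polynomial, its positive roots form a finite set, so
  \<open>LEAST\<close> picks a genuine smallest one whenever there is any.\<close>

definition lambda_star :: "real \<Rightarrow> real \<Rightarrow> ereal" where
  "lambda_star a \<gamma> =
     (if frb_cubic a \<gamma> = 0 \<or> (\<forall>l>0. poly (frb_cubic a \<gamma>) l \<noteq> 0) then \<infinity>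
      else ereal (LEAST l. 0 < l \<and> poly (frb_cubic a \<gamma>) l = 0))"

end

theory Submission
  imports Defs
begin

text \<open>
  Let \<open>r1\<close>, \<open>r2\<close> be the roots of the characteristic polynomial
  \<open>p r^2 - (1 - 2 \<i> lam) r - \<i> lam\<close>, where \<open>p = 1 + lam (a + \<i> \<gamma>)\<close>, and put
  \<open>D = |p|^2 - lam^2\<close>. The Schur-Cohn identity
  \<open>|p|^4 (1 - |r1|^2) (1 - |r2|^2) |1 - cnj r1 r2|^2 = lam P(lam)\<close>
  shows that the roots lie on different sides of the unit circle if \<open>P(lam) < 0\<close>, and that
  both lie inside it if \<open>P(lam) > 0\<close> and \<open>D > 0\<close>. As \<open>lam P(lam) \<le> D^2\<close> and \<open>D = 1\<close> at
  \<open>lam = 0\<close>, the quantity \<open>D\<close> stays positive up to the first positive root of \<open>P\<close>.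

  If \<open>A\<^sub>3 \<ge> 0\<close> and \<open>P \<noteq> 0\<close>, then \<open>a^2 + \<gamma>^2 \<ge> 1\<close>, so all coefficients are nonnegative and \<open>P\<close>
  has no positive root; if \<open>A\<^sub>3 < 0\<close>, the coefficients change sign once. Hence a positive root
  of \<open>P\<close> is unique and \<open>P\<close> is negative to the right of it. The global bound follows from
  \<open>8 P(1/2) = (\<gamma>^2 - 1)^2 + a (a^3 + 8 a^2 + 14 a + 8 + 2 a \<gamma>^2 + 8 \<gamma>^2) \<ge> 0\<close>.
\<close>

subsection \<open>Two-term linear recursions\<close>

text \<open>In terms of the shift \<open>E\<close>, the recursion is
  \<open>(E - r2) (E - r1) z = 0\<close>. So \<open>(E - r1) z\<close> is annihilated by
  \<open>E - r2\<close>, that is, geometric with ratio \<open>r2\<close>.\<close>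

lemma linear_recursion_geometric:
  fixes z :: "nat \<Rightarrow> 'a::comm_ring_1"
  assumes rec: "\<And>n. z (Suc (Suc n)) = (r1 + r2) * z (Suc n) - r1 * r2 * z n"
  shows "z (Suc n) - r1 * z n = r2 ^ n * (z 1 - r1 * z 0)"
proof (induction n)
  case (Suc n)
  have "z (Suc (Suc n)) - r1 * z (Suc n) = r2 * (z (Suc n) - r1 * z n)"
    by (simp add: rec algebra_simps)
  then show ?case by (simp add: Suc mult.assoc)
qed simp

text \<open>The roots may coincide, so no combination of two geometric sequences is used. A bound of
  the form \<open>(c + n K) R^n\<close> with \<open>R < 1\<close> also covers a double root.\<close>

lemma linear_recursion_tendsto_0:
  fixes z :: "nat \<Rightarrow> complex"
  assumes rec: "\<And>n. z (Suc (Suc n)) = (r1 + r2) * z (Suc n) - r1 * r2 * z n"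
    and r: "cmod r1 < 1" "cmod r2 < 1"
  shows "z \<longlonglongrightarrow> 0"
proof -
  \<comment> \<open>The entry \<open>1/2\<close> in the maximum keeps \<open>R\<close> positive even
    if both roots vanish, which allows the division by \<open>R\<close> in \<open>K\<close>.\<close>
  obtain R where R: "cmod r1 \<le> R" "cmod r2 \<le> R" "0 < R" "R < 1"
  proof
    show "cmod r1 \<le> max (1/2) (max (cmod r1) (cmod r2))"
      "cmod r2 \<le> max (1/2) (max (cmod r1) (cmod r2))" by auto
    show "0 < max (1/2) (max (cmod r1) (cmod r2))" by (auto simp: less_max_iff_disj)
    show "max (1/2) (max (cmod r1) (cmod r2)) < 1" using r by auto
  qed
  define w where "w n = z (Suc n) - r1 * z n" for n
  define K where "K = cmod (w 0) / R"
  have w: "w n = r2 ^ n * w 0" for n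
    unfolding w_def One_nat_def[symmetric] by (rule linear_recursion_geometric) (rule rec)
  have bound: "cmod (z n) \<le> (cmod (z 0) + real n * K) * R ^ n" for n
  proof (induction n)
    case 0
    then show ?case by simp
  next
    case (Suc n)
    have "cmod (w n) \<le> R ^ n * cmod (w 0)"
      by (subst w) (simp add: norm_mult norm_power mult_right_mono power_mono R)
    also have "\<dots> = K * R ^ Suc n" using R by (simp add: K_def)
    finally have 1: "cmod (w n) \<le> K * R ^ Suc n" .
    have "cmod (r1 * z n) \<le> R * ((cmod (z 0) + real n * K) * R ^ n)"
      unfolding norm_mult by (rule mult_mono) (use R Suc in auto)
    moreover have "cmod (z (Suc n)) \<le> cmod (r1 * z n) + cmod (w n)"
      using norm_triangle_ineq[of "r1 * z n" "w n"] by (simp add: w_def)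
    ultimately show ?case using 1 by (simp add: algebra_simps)
  qed
  have "(\<lambda>n. cmod (z 0) * R ^ n + K * (real n * R ^ n)) \<longlonglongrightarrow> cmod (z 0) * 0 + K * 0"
    using R by (intro tendsto_intros LIMSEQ_realpow_zero) (auto intro: powser_times_n_limit_0)
  then have "(\<lambda>n. (cmod (z 0) + real n * K) * R ^ n) \<longlonglongrightarrow> 0"
    by (simp add: algebra_simps)
  then show ?thesis
    by (rule Lim_null_comparison[rotated]) (use bound in auto)
qed

text \<open>The roots are 1 and \<open>r\<close>. The root 1 makes
  \<open>z (Suc n) - r * z n\<close> constant, so \<open>z\<close> iterates an affine contraction,
  and \<open>L\<close> is its fixed point.\<close>

lemma linear_recursion_convergent:
  fixes z :: "nat \<Rightarrow> complex"
  assumes rec: "\<And>n. z (Suc (Suc n)) = (1 + r) * z (Suc n) - r * z n"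
    and r: "cmod r < 1"
  shows "convergent z"
proof -
  have r1: "r \<noteq> 1" using r by auto
  define L where "L = (z 1 - r * z 0) / (1 - r)"
  have 1: "z (Suc n) - r * z n = z 1 - r * z 0" for n
    using linear_recursion_geometric[of z r 1 n] rec by (simp add: add.commute)
  have step: "z (Suc n) - L = r * (z n - L)" for n
  proof -
    have "(1 - r) * L = z 1 - r * z 0" using r1 by (simp add: L_def)
    then show ?thesis using 1[of n] by algebra
  qed
  have "z n - L = r ^ n * (z 0 - L)" for n
    by (induction n) (simp_all add: step)
  then have "(\<lambda>n. z n - L) = (\<lambda>n. r ^ n * (z 0 - L))" by (rule ext)
  moreover have "(\<lambda>n. r ^ n * (z 0 - L)) \<longlonglongrightarrow> 0"
    using r by (intro tendsto_mult_left_zero LIMSEQ_power_zero)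
  ultimately have "(\<lambda>n. z n - L) \<longlonglongrightarrow> 0" by (simp only:)
  then show ?thesis by (auto simp: LIM_zero_iff convergent_def)
qed

text \<open>The condition on \<open>z 1\<close> says that the component along the expanding root
  \<open>r1\<close> is nonzero. Subtracting the geometric identities for the two orders of the roots
  isolates \<open>z n\<close>, whose \<open>r1\<close> part grows while the \<open>r2\<close> part
  stays bounded.\<close>

lemma linear_recursion_at_infinity:
  fixes z :: "nat \<Rightarrow> complex"
  assumes rec: "\<And>n. z (Suc (Suc n)) = (r1 + r2) * z (Suc n) - r1 * r2 * z n"
    and r: "cmod r1 > 1" "cmod r2 < 1" and z: "z 1 \<noteq> r2 * z 0"
  shows "filterlim (\<lambda>n. cmod (z n)) at_top sequentially"
proof -
  have ne: "r1 \<noteq> r2" using r by auto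
  define c where "c = cmod (z 1 - r2 * z 0)"
  define d where "d = cmod (z 1 - r1 * z 0)"
  have c: "c > 0" using z by (simp add: c_def)
  have 1: "z (Suc n) - r2 * z n = r1 ^ n * (z 1 - r2 * z 0)" for n
    by (rule linear_recursion_geometric) (simp add: rec add.commute mult.commute)
  have 2: "z (Suc n) - r1 * z n = r2 ^ n * (z 1 - r1 * z 0)" for n
    by (rule linear_recursion_geometric) (rule rec)
  have bound: "(cmod r1 ^ n * c - d) / cmod (r1 - r2) \<le> cmod (z n)" for n
  proof -
    have "(r1 - r2) * z n = r1 ^ n * (z 1 - r2 * z 0) - r2 ^ n * (z 1 - r1 * z 0)"
      unfolding 1[symmetric] 2[symmetric] by (simp add: algebra_simps)
    then have "cmod (r1 - r2) * cmod (z n) =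
        cmod (r1 ^ n * (z 1 - r2 * z 0) - r2 ^ n * (z 1 - r1 * z 0))"
      by (simp only: norm_mult[symmetric])
    also have "\<dots> \<ge> cmod (r1 ^ n * (z 1 - r2 * z 0)) - cmod (r2 ^ n * (z 1 - r1 * z 0))"
      by (rule norm_triangle_ineq2)
    finally have "cmod (r1 - r2) * cmod (z n) \<ge>
        cmod (r1 ^ n * (z 1 - r2 * z 0)) - cmod (r2 ^ n * (z 1 - r1 * z 0))" .
    moreover have "cmod (r2 ^ n * (z 1 - r1 * z 0)) \<le> d"
      using r by (simp add: d_def norm_mult norm_power mult_left_le_one_le power_le_one)
    ultimately have "cmod (r1 - r2) * cmod (z n) \<ge> cmod r1 ^ n * c - d"
      by (simp add: c_def norm_mult norm_power)
    then show ?thesis using ne by (simp add: field_simps)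
  qed
  have lim: "filterlim (\<lambda>n. (cmod r1 ^ n * c - d) / cmod (r1 - r2)) at_top sequentially"
  proof -
    have "filterlim (\<lambda>n. cmod r1 ^ n) at_top sequentially"
      using r filterlim_realpow_sequentially_gt1[of "cmod r1"]
      by (auto dest!: filterlim_at_infinity_imp_norm_at_top simp: norm_power)
    then have "filterlim (\<lambda>n. (- d + c * cmod r1 ^ n) * inverse (cmod (r1 - r2))) at_top sequentially"
      using c ne
      by (intro filterlim_at_top_mult_tendsto_pos[OF tendsto_const]
          filterlim_tendsto_add_at_top[OF tendsto_const]
          filterlim_tendsto_pos_mult_at_top[OF tendsto_const]) auto
    then show ?thesis by (simp add: field_simps)
  qed
  show ?thesis
    by (rule filterlim_at_top_mono[OF lim always_eventually[OF allI[OF bound]]])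
qed

subsection \<open>The Schur-Cohn identity\<close>

text \<open>Here \<open>b\<close> and \<open>c\<close> are the coefficients of the monic quadratic
  \<open>x^2 + b x + c\<close> with roots \<open>r1\<close>, \<open>r2\<close>. With each squared
  modulus written as \<open>w * cnj w\<close>, the claim is a polynomial identity in the roots and
  their conjugates.\<close>

lemma schur_cohn_identity:
  fixes r1 r2 :: complex
  defines "b \<equiv> - (r1 + r2)" and "c \<equiv> r1 * r2"
  shows "(1 - (cmod c)\<^sup>2)\<^sup>2 - (cmod (b - c * cnj b))\<^sup>2 =
    (1 - (cmod r1)\<^sup>2) * (1 - (cmod r2)\<^sup>2) * (cmod (1 - cnj r1 * r2))\<^sup>2"
proof -
  have "of_real ((1 - (cmod c)\<^sup>2)\<^sup>2 - (cmod (b - c * cnj b))\<^sup>2) =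
      (of_real ((1 - (cmod r1)\<^sup>2) * (1 - (cmod r2)\<^sup>2) * (cmod (1 - cnj r1 * r2))\<^sup>2) :: complex)"
    unfolding of_real_mult of_real_diff of_real_power[of "1 - _"] of_real_1 complex_norm_square
      b_def c_def complex_cnj_mult complex_cnj_add complex_cnj_diff complex_cnj_minus
      complex_cnj_cnj complex_cnj_one
    by algebra
  then show ?thesis by (simp only: of_real_eq_iff)
qed

lemma poly_frb_cubic:
  "poly (frb_cubic a \<gamma>) l =
    (a^4 + 2 * a^2 * \<gamma>^2 - 6 * a^2 + \<gamma>^4 - 6 * \<gamma>^2 - 8 * \<gamma> - 3) * l^3
    + (4 * a^3 + 4 * a * \<gamma>^2 - 4 * a) * l^2 + (5 * a^2 + \<gamma>^2 + 2 * \<gamma> + 1) * l + 2 * a"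
  unfolding frb_cubic_def by (simp, algebra)

text \<open>The right side is \<open>D^2 - N\<close>, where \<open>N\<close> is the squared modulus
  of \<open>cnj p * q + \<i> * lam * cnj q\<close> with \<open>q = 1 - 2 * \<i> * lam\<close>, split
  into real and imaginary part. In particular \<open>lam P(lam)\<close> is at most
  \<open>D^2\<close>.\<close>

lemma lam_times_frb_cubic:
  "lam * poly (frb_cubic a \<gamma>) lam = ((1 + lam * a)\<^sup>2 + lam\<^sup>2 * \<gamma>\<^sup>2 - lam\<^sup>2)\<^sup>2 -
    ((1 + lam * a - 2 * lam\<^sup>2 * \<gamma> - 2 * lam\<^sup>2)\<^sup>2
      + (lam * \<gamma> + 2 * lam * (1 + lam * a) - lam)\<^sup>2)"
  unfolding poly_frb_cubic by algebra

text \<open>The quadratic formula supplies the roots. Scaling the Schur-Cohn identity by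
  \<open>(cmod p)^4\<close> then expresses it through \<open>D\<close> and the cubic.\<close>

lemma frb_charpoly_factor:
  fixes lam :: real
  assumes p: "p \<noteq> 0" and p_def: "p = 1 + of_real lam * (of_real a + \<i> * of_real \<gamma>)"
  obtains r1 r2 where "p * (r1 + r2) = 1 - 2 * \<i> * lam" "p * (r1 * r2) = - (\<i> * lam)"
    "(cmod p)^2 * (1 - (cmod r1)\<^sup>2 * (cmod r2)\<^sup>2) = (1 + lam * a)\<^sup>2 + lam\<^sup>2 * \<gamma>\<^sup>2 - lam\<^sup>2"
    "(cmod p)^4 * ((1 - (cmod r1)\<^sup>2) * (1 - (cmod r2)\<^sup>2) * (cmod (1 - cnj r1 * r2))\<^sup>2)
      = lam * poly (frb_cubic a \<gamma>) lam"
proof -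
  define q where "q = 1 - 2 * \<i> * complex_of_real lam"
  define s where "s = csqrt (q\<^sup>2 + 4 * p * (\<i> * lam))"
  define r1 r2 where "r1 = (q + s) / (2 * p)" and "r2 = (q - s) / (2 * p)"
  have s: "s\<^sup>2 = q\<^sup>2 + 4 * p * (\<i> * lam)" by (simp add: s_def)
  have sum: "p * (r1 + r2) = q" using p by (simp add: r1_def r2_def field_simps)
  have "4 * (p * p) * (r1 * r2) = (q + s) * (q - s)"
    using p by (simp add: r1_def r2_def field_simps)
  also have "\<dots> = 4 * p * (- (\<i> * lam))"
    using s by (simp add: power2_eq_square algebra_simps)
  finally have "4 * p * (p * (r1 * r2)) = 4 * p * (- (\<i> * lam))" by (simp only: mult.assoc)
  then have prod: "p * (r1 * r2) = - (\<i> * lam)" using p by (subst (asm) mult_left_cancel) auto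
  have np: "(cmod p)\<^sup>2 = (1 + lam * a)\<^sup>2 + (lam * \<gamma>)\<^sup>2" by (simp add: cmod_power2 p_def)
  have "cmod (p * (r1 * r2)) ^ 2 = lam\<^sup>2" unfolding prod by (simp add: norm_mult)
  then have prod2: "(cmod p)\<^sup>2 * ((cmod r1)\<^sup>2 * (cmod r2)\<^sup>2) = lam\<^sup>2"
    by (simp add: norm_mult power_mult_distrib)
  then have D: "(cmod p)\<^sup>2 * (1 - (cmod r1)\<^sup>2 * (cmod r2)\<^sup>2) = (1 + lam * a)\<^sup>2 + lam\<^sup>2 * \<gamma>\<^sup>2 - lam\<^sup>2"
    using np by (simp add: algebra_simps power_mult_distrib)
  let ?b = "- (r1 + r2)" and ?c = "r1 * r2"
  \<comment> \<open>The factor \<open>p * cnj p\<close> clears the denominators: \<open>?b\<close>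
    and \<open>?c\<close> are quotients by \<open>p\<close>, and \<open>cnj ?b\<close> is a quotient
    by \<open>cnj p\<close>.\<close>
  have "p * cnj p * (?b - ?c * cnj ?b) = - (cnj p * (p * (r1 + r2))) + (p * (r1 * r2)) * cnj (p * (r1 + r2))"
    by (simp add: algebra_simps)
  also have "\<dots> = - (cnj p * q) - \<i> * lam * cnj q" unfolding sum prod by simp
  finally have N': "p * cnj p * (?b - ?c * cnj ?b) = - (cnj p * q) - \<i> * lam * cnj q" .
  have "(cmod p)^4 * (cmod (?b - ?c * cnj ?b))\<^sup>2 = (cmod (p * cnj p * (?b - ?c * cnj ?b)))\<^sup>2"
    unfolding norm_mult complex_mod_cnj by algebra
  also have "\<dots> = (1 + lam * a - 2 * lam\<^sup>2 * \<gamma> - 2 * lam\<^sup>2)\<^sup>2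
        + (lam * \<gamma> + 2 * lam * (1 + lam * a) - lam)\<^sup>2"
    unfolding N' cmod_power2 by (simp add: p_def q_def, algebra)
  finally have N: "(cmod p)^4 * (cmod (?b - ?c * cnj ?b))\<^sup>2 = \<dots>" .
  have "(cmod p)^4 * ((1 - (cmod r1)\<^sup>2) * (1 - (cmod r2)\<^sup>2) * (cmod (1 - cnj r1 * r2))\<^sup>2)
     = ((cmod p)\<^sup>2 * (1 - (cmod r1)\<^sup>2 * (cmod r2)\<^sup>2))\<^sup>2 - (cmod p)^4 * (cmod (?b - ?c * cnj ?b))\<^sup>2"
    unfolding schur_cohn_identity[symmetric] norm_mult by algebra
  also have "\<dots> = lam * poly (frb_cubic a \<gamma>) lam"
    unfolding D N lam_times_frb_cubic ..
  finally show ?thesis using that sum prod D unfolding q_def by blast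
qed

subsection \<open>The cubic\<close>

lemma frb_cubic_eq_0_iff: "frb_cubic a \<gamma> = 0 \<longleftrightarrow> a = 0 \<and> \<gamma> = -1"
proof -
  have "\<gamma> = -1" if "\<gamma>^2 + 2 * \<gamma> + 1 = 0"
  proof -
    have "(\<gamma> + 1)^2 = 0" using that by (simp add: power2_eq_square algebra_simps)
    then show ?thesis by simp
  qed
  then show ?thesis by (auto simp: frb_cubic_def)
qed

lemma frb_cubic_low_coeffs:
  fixes a \<gamma> :: real
  assumes "a \<ge> 0" "\<not> (a = 0 \<and> \<gamma> = -1)"
  shows "5 * a^2 + \<gamma>^2 + 2 * \<gamma> + 1 > 0"
proof -
  have eq: "5 * a^2 + \<gamma>^2 + 2 * \<gamma> + 1 = 5 * a^2 + (\<gamma> + 1)^2"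
    by (simp add: power2_eq_square algebra_simps)
  show ?thesis
  proof (cases "a = 0")
    case True
    then have "\<gamma> + 1 \<noteq> 0" using assms by auto
    then show ?thesis unfolding eq using True by simp
  next
    case False
    then show ?thesis unfolding eq by (intro add_pos_nonneg) auto
  qed
qed

text \<open>With \<open>t\<close> the Euclidean norm of \<open>(a, \<gamma>)\<close>, the
  coefficient is \<open>t^4 - 6 t^2 - 8 \<gamma> - 3\<close>. Its largest value on the circle of
  radius \<open>t\<close> is at \<open>\<gamma> = -t\<close>, where it factors as
  \<open>-(1 - t)^3 (t + 3)\<close>.\<close>

lemma frb_cubic_leading_coeff_neg:
  fixes a \<gamma> :: real
  assumes "a^2 + \<gamma>^2 < 1"
  shows "a^4 + 2 * a^2 * \<gamma>^2 - 6 * a^2 + \<gamma>^4 - 6 * \<gamma>^2 - 8 * \<gamma> - 3 < 0"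
proof -
  define t where "t = sqrt (a^2 + \<gamma>^2)"
  have t2: "t^2 = a^2 + \<gamma>^2" by (simp add: t_def)
  have "t < 1" using assms by (simp add: t_def)
  have "0 \<le> t" by (simp add: t_def)
  have "\<bar>\<gamma>\<bar> \<le> t" unfolding t_def by (rule real_le_rsqrt) simp
  have "a^4 + 2 * a^2 * \<gamma>^2 - 6 * a^2 + \<gamma>^4 - 6 * \<gamma>^2 - 8 * \<gamma> - 3
      = (t^2)^2 - 6 * t^2 - 8 * \<gamma> - 3"
    unfolding t2 by algebra
  also have "\<dots> \<le> (t^2)^2 - 6 * t^2 + 8 * t - 3" using \<open>\<bar>\<gamma>\<bar> \<le> t\<close> by simp
  also have "\<dots> = - ((1 - t)^3 * (t + 3))" by algebra
  also have "\<dots> < 0" using \<open>t < 1\<close> \<open>0 \<le> t\<close> by simp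
  finally show ?thesis .
qed

text \<open>A positive root forces \<open>A3 < 0\<close>. Then \<open>P(x) / x^2\<close> (if
  \<open>A2\<close> is nonnegative) or \<open>P(x) / x\<close> (if \<open>A2\<close> is negative) is
  strictly decreasing for \<open>x > 0\<close>.\<close>

lemma frb_cubic_neg_after_root:
  assumes a: "a \<ge> 0" and nz: "\<not> (a = 0 \<and> \<gamma> = -1)"
    and l: "0 < l" "poly (frb_cubic a \<gamma>) l = 0" and m: "l < m"
  shows "poly (frb_cubic a \<gamma>) m < 0"
proof -
  define A3 where "A3 = a^4 + 2 * a^2 * \<gamma>^2 - 6 * a^2 + \<gamma>^4 - 6 * \<gamma>^2 - 8 * \<gamma> - 3"
  define A2 where "A2 = 4 * a^3 + 4 * a * \<gamma>^2 - 4 * a"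
  define A1 where "A1 = 5 * a^2 + \<gamma>^2 + 2 * \<gamma> + 1"
  have P: "poly (frb_cubic a \<gamma>) x = A3 * x^3 + A2 * x^2 + A1 * x + 2 * a" for x
    by (simp add: poly_frb_cubic A3_def A2_def A1_def)
  have A1: "A1 > 0" unfolding A1_def by (rule frb_cubic_low_coeffs[OF a nz])
  have A2: "A2 = 4 * a * (a^2 + \<gamma>^2 - 1)" unfolding A2_def by algebra
  have A3: "A3 < 0"
  proof (rule ccontr)
    assume "\<not> A3 < 0"
    then have "a^2 + \<gamma>^2 \<ge> 1" using frb_cubic_leading_coeff_neg[of a \<gamma>] unfolding A3_def by linarith
    then have "A2 \<ge> 0" using a unfolding A2 by simp
    then have "A3 * l^3 + A2 * l^2 + A1 * l + 2 * a > 0"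
      using \<open>\<not> A3 < 0\<close> A1 a l by (intro add_pos_nonneg add_nonneg_pos add_nonneg_nonneg) auto
    then show False using l(2) unfolding P by simp
  qed
  have "0 < m" using l m by simp
  show ?thesis
  proof (cases "A2 \<ge> 0")
    case True
    \<comment> \<open>Comparison of \<open>P(m) / m^2\<close> with \<open>P(l) / l^2\<close>, with
      denominators cleared; the term in \<open>A2\<close> cancels.\<close>
    have "l^2 * poly (frb_cubic a \<gamma>) m =
        m^2 * poly (frb_cubic a \<gamma>) l + (m - l) * (A3 * m^2 * l^2 - A1 * m * l - 2 * a * (m + l))"
      unfolding P by algebra
    also have "\<dots> = (m - l) * (A3 * m^2 * l^2 - A1 * m * l - 2 * a * (m + l))"
      using l by simp
    also have "\<dots> < 0"
    proof -
      have "A3 * m^2 * l^2 < 0" using A3 l \<open>0 < m\<close> by (simp add: mult_neg_pos)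
      moreover have "A1 * m * l > 0" using A1 l \<open>0 < m\<close> by simp
      moreover have "2 * a * (m + l) \<ge> 0" using a l \<open>0 < m\<close> by simp
      ultimately show ?thesis using m by (intro mult_pos_neg) auto
    qed
    finally show ?thesis using l by (simp add: mult_less_0_iff)
  next
    case False
    \<comment> \<open>The same comparison for \<open>P(x) / x\<close>, where the term in
      \<open>A1\<close> cancels.\<close>
    have "l * poly (frb_cubic a \<gamma>) m =
        m * poly (frb_cubic a \<gamma>) l + (m - l) * (A3 * m * l * (m + l) + A2 * m * l - 2 * a)"
      unfolding P by algebra
    also have "\<dots> = (m - l) * (A3 * m * l * (m + l) + A2 * m * l - 2 * a)"
      using l by simp
    also have "\<dots> < 0"
    proof -
      have "A3 * m * l * (m + l) < 0" using A3 l \<open>0 < m\<close> by (simp add: mult_neg_pos)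
      moreover have "A2 * m * l < 0" using False l \<open>0 < m\<close> by (simp add: mult_neg_pos)
      ultimately show ?thesis using m a by (intro mult_pos_neg) auto
    qed
    finally show ?thesis using l by (simp add: mult_less_0_iff)
  qed
qed

text \<open>If \<open>a > 0\<close>, then already \<open>P(0) = 2 a > 0\<close>. If
  \<open>a = 0\<close>, the constant term vanishes and \<open>P(l) / l\<close>, which tends to
  \<open>A1 > 0\<close>, gives the sign.\<close>

lemma frb_cubic_pos_near_0:
  assumes a: "a \<ge> 0" and nz: "\<not> (a = 0 \<and> \<gamma> = -1)" and lam: "0 < lam"
  obtains e where "0 < e" "e < lam" "poly (frb_cubic a \<gamma>) e > 0"
proof -
  have "eventually (\<lambda>l. poly (frb_cubic a \<gamma>) l > 0) (at_right 0)"
  proof (cases "a = 0")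
    case False
    have "((\<lambda>l. poly (frb_cubic a \<gamma>) l) \<longlongrightarrow> poly (frb_cubic a \<gamma>) 0) (at_right 0)"
      by (intro tendsto_intros)
    moreover have "poly (frb_cubic a \<gamma>) 0 > 0" using False a by (simp add: poly_frb_cubic)
    ultimately show ?thesis by (rule order_tendstoD)
  next
    case True
    let ?Q = "\<lambda>l. (\<gamma>^4 - 6 * \<gamma>^2 - 8 * \<gamma> - 3) * l^2 + (\<gamma>^2 + 2 * \<gamma> + 1)"
    have "(?Q \<longlongrightarrow> ?Q 0) (at_right 0)" by (intro tendsto_intros)
    moreover have "?Q 0 > 0" using frb_cubic_low_coeffs[OF a nz] True by simp
    ultimately have "eventually (\<lambda>l. ?Q l > 0) (at_right 0)" by (rule order_tendstoD)
    then show ?thesis using eventually_at_right_less[of 0]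
    proof eventually_elim
      case (elim l)
      have "poly (frb_cubic a \<gamma>) l = l * ?Q l" unfolding poly_frb_cubic True by (simp, algebra)
      then show ?case using elim by simp
    qed
  qed
  then have "eventually (\<lambda>l. poly (frb_cubic a \<gamma>) l > 0 \<and> 0 < l \<and> l < lam) (at_right 0)"
    using eventually_at_right_less[of 0] eventually_at_rightI[of 0 lam "\<lambda>l. l < lam"] lam
    by (auto simp: eventually_conj_iff)
  then show ?thesis using that eventually_happens trivial_limit_at_right_real by blast
qed

lemma frb_cubic_root_of_nonpos:
  assumes a: "a \<ge> 0" and nz: "\<not> (a = 0 \<and> \<gamma> = -1)" and lam: "0 < lam"
    and P: "poly (frb_cubic a \<gamma>) lam \<le> 0"
  obtains l where "0 < l" "l \<le> lam" "poly (frb_cubic a \<gamma>) l = 0"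
proof -
  obtain e where e: "0 < e" "e < lam" "poly (frb_cubic a \<gamma>) e > 0"
    using frb_cubic_pos_near_0[OF a nz lam] .
  have "\<exists>x. e \<le> x \<and> x \<le> lam \<and> poly (frb_cubic a \<gamma>) x = 0"
    by (rule IVT2) (use e P in auto)
  then show ?thesis using that e(1) order_less_le_trans by blast
qed

section \<open>The threshold and the sign of the cubic on either side of it\<close>

lemma lambda_star_eq_root:
  assumes a: "a \<ge> 0" and nz: "\<not> (a = 0 \<and> \<gamma> = -1)"
    and l: "0 < l" "poly (frb_cubic a \<gamma>) l = 0"
  shows "lambda_star a \<gamma> = ereal l"
proof -
  have "(LEAST l. 0 < l \<and> poly (frb_cubic a \<gamma>) l = 0) = l"
  proof (rule Least_equality)
    fix m assume m: "0 < m \<and> poly (frb_cubic a \<gamma>) m = 0"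
    show "l \<le> m"
      using frb_cubic_neg_after_root[OF a nz, of m l] m l by force
  qed (use l in auto)
  then show ?thesis using l nz by (auto simp: lambda_star_def frb_cubic_eq_0_iff)
qed

lemma frb_cubic_pos_below_lambda_star:
  assumes a: "a \<ge> 0" and nz: "\<not> (a = 0 \<and> \<gamma> = -1)"
    and lam: "0 < lam" "ereal lam < lambda_star a \<gamma>"
  shows "poly (frb_cubic a \<gamma>) lam > 0"
proof (rule ccontr)
  assume "\<not> ?thesis"
  then obtain l where "0 < l" "l \<le> lam" "poly (frb_cubic a \<gamma>) l = 0"
    using frb_cubic_root_of_nonpos[OF a nz lam(1)] by force
  then show False using lambda_star_eq_root[OF a nz] lam by force
qed

text \<open>A real number above the threshold makes the threshold finite. This excludes the
  degenerate point and supplies a positive root below \<open>lam\<close>.\<close>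

lemma frb_cubic_neg_above_lambda_star:
  assumes a: "a \<ge> 0" and lam: "ereal lam > lambda_star a \<gamma>"
  shows "0 < lam" "poly (frb_cubic a \<gamma>) lam < 0" "\<not> (a = 0 \<and> \<gamma> = -1)"
proof -
  have "lambda_star a \<gamma> \<noteq> \<infinity>" using lam by auto
  then obtain l where nz: "frb_cubic a \<gamma> \<noteq> 0" and l: "0 < l" "poly (frb_cubic a \<gamma>) l = 0"
    by (auto simp: lambda_star_def split: if_splits)
  show nz: "\<not> (a = 0 \<and> \<gamma> = -1)" using nz by (simp add: frb_cubic_eq_0_iff)
  have "l < lam" using lam lambda_star_eq_root[OF a nz l] by simp
  then show "0 < lam" "poly (frb_cubic a \<gamma>) lam < 0"
    using l frb_cubic_neg_after_root[OF a nz l] by auto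
qed

lemma frb_gap_pos_below_lambda_star:
  assumes a: "a \<ge> 0" and nz: "\<not> (a = 0 \<and> \<gamma> = -1)"
    and lam: "0 < lam" "ereal lam < lambda_star a \<gamma>"
  shows "(1 + lam * a)\<^sup>2 + lam\<^sup>2 * \<gamma>\<^sup>2 - lam\<^sup>2 > 0"
proof (rule ccontr)
  let ?D = "\<lambda>m. (1 + m * a)\<^sup>2 + m\<^sup>2 * \<gamma>\<^sup>2 - m\<^sup>2"
  assume "\<not> ?D lam > 0"
  then have "\<exists>x\<ge>0. x \<le> lam \<and> ?D x = 0"
    by (intro IVT2) (use lam in auto)
  then obtain m where m: "0 \<le> m" "m \<le> lam" "?D m = 0" by blast
  have "m \<noteq> 0" using m by auto
  then have "m > 0" using m by simp
  \<comment> \<open>At a zero of \<open>?D\<close> only the negated sum of squares remains, against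
    the positivity of the cubic below the threshold.\<close>
  have "m * poly (frb_cubic a \<gamma>) m \<le> 0"
    unfolding lam_times_frb_cubic m(3) by simp
  then have "poly (frb_cubic a \<gamma>) m \<le> 0" using \<open>m > 0\<close> by (simp add: mult_le_0_iff)
  moreover have "ereal m < lambda_star a \<gamma>"
    using m lam by (meson ereal_less_eq(3) order_le_less_trans)
  ultimately show False using frb_cubic_pos_below_lambda_star[OF a nz \<open>m > 0\<close>] by simp
qed

text \<open>The cubic is \<open>4 l - 16 l^3\<close> at this point.\<close>

lemma lambda_star_0_1: "lambda_star 0 1 = ereal (1 / 2)"
  by (rule lambda_star_eq_root) (simp_all add: poly_frb_cubic power_divide)

lemma lambda_star_ge_half:
  assumes a: "a \<ge> 0"
  shows "ereal (1 / 2) \<le> lambda_star a \<gamma>"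
proof (rule ccontr)
  assume "\<not> ?thesis"
  then have "lambda_star a \<gamma> < ereal (1 / 2)" by simp
  then have "poly (frb_cubic a \<gamma>) (1 / 2) < 0"
    using frb_cubic_neg_above_lambda_star[OF a] by blast
  \<comment> \<open>For \<open>a = 0\<close> only \<open>(\<gamma>^2 - 1)^2\<close> remains; it
    vanishes at \<open>\<gamma> = 1\<close>, where the bound is attained.\<close>
  moreover have "8 * poly (frb_cubic a \<gamma>) (1 / 2) =
      (\<gamma>\<^sup>2 - 1)\<^sup>2 + a * (a^3 + 8 * a\<^sup>2 + 14 * a + 8 + 2 * a * \<gamma>\<^sup>2 + 8 * \<gamma>\<^sup>2)"
    unfolding poly_frb_cubic by (simp add: field_simps power2_eq_square power3_eq_cube power4_eq_xxxx)
  moreover have "\<dots> \<ge> 0"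
    using a by (intro add_nonneg_nonneg mult_nonneg_nonneg) auto
  ultimately show False by linarith
qed

subsection \<open>Passage to complex numbers\<close>

definition to_complex :: "real ^ 2 \<Rightarrow> complex" where
  "to_complex x = Complex (x $ 1) (x $ 2)"

definition of_complex :: "complex \<Rightarrow> real ^ 2" where
  "of_complex z = vector [Re z, Im z]"

lemma to_of_complex [simp]: "to_complex (of_complex z) = z"
  by (simp add: to_complex_def of_complex_def)

lemma of_to_complex [simp]: "of_complex (to_complex x) = x"
  by (simp add: to_complex_def of_complex_def vec_eq_iff forall_2)

lemma to_complex_eq_iff: "to_complex x = to_complex y \<longleftrightarrow> x = y"
  by (metis of_to_complex)

lemma linear_to_complex: "linear to_complex"
  by (rule linearI) (simp_all add: to_complex_def complex_eq_iff)

lemma linear_of_complex: "linear of_complex"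
  by (rule linearI) (simp_all add: of_complex_def vec_eq_iff forall_2)

lemmas to_complex_simps [simp] =
  linear_add[OF linear_to_complex] linear_diff[OF linear_to_complex]
  linear_cmul[OF linear_to_complex, unfolded scaleR_conv_of_real[where 'a=complex]]
  linear_0[OF linear_to_complex]

lemma norm_to_complex: "cmod (to_complex x) = norm x"
  by (simp add: to_complex_def cmod_def norm_vec_def L2_set_def sum_2)

lemma to_complex_rotJ [simp]: "to_complex (rotJ x) = \<i> * to_complex x"
  by (simp add: to_complex_def rotJ_def complex_eq_iff)

lemma to_complex_opA [simp]:
  "to_complex (opA a \<gamma> x) = (a + \<i> * \<gamma>) * to_complex x"
  by (simp add: opA_def algebra_simps)

text \<open>On complex numbers, \<open>A + B\<close> is multiplication by
  \<open>a + \<i> * (\<gamma> + 1)\<close>, which is injective unless this factor is zero.\<close>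

lemma zer_sum_opA_rotJ:
  "zer_sum (opA a \<gamma>) rotJ = (if a = 0 \<and> \<gamma> = -1 then UNIV else {0})"
proof -
  have "opA a \<gamma> x + rotJ x = 0 \<longleftrightarrow> (a + \<i> * (\<gamma> + 1)) * to_complex x = 0" for x
    unfolding to_complex_eq_iff[symmetric] by (simp add: algebra_simps)
  also have "\<dots> x \<longleftrightarrow> a = 0 \<and> \<gamma> = -1 \<or> x = 0" for x
    using to_complex_eq_iff[of x 0] unfolding mult_eq_0_iff by (auto simp: complex_eq_iff)
  finally show ?thesis by (auto simp: zer_sum_def)
qed

text \<open>The real part is \<open>1 + lam * a\<close>, which is at least 1.\<close>

lemma frb_multiplier_nonzero:
  fixes a \<gamma> lam :: real
  assumes "a \<ge> 0" "lam > 0"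
  shows "1 + lam * (a + \<i> * \<gamma>) \<noteq> 0"
proof
  assume "1 + lam * (a + \<i> * \<gamma>) = 0"
  then have "Re (1 + lam * (a + \<i> * \<gamma>)) = 0" by (simp only: zero_complex.sel)
  then have "1 + lam * a = 0" by simp
  moreover have "lam * a \<ge> 0" using assms by simp
  ultimately show False by linarith
qed

lemma to_complex_resolvent:
  assumes "a \<ge> 0" "lam > 0"
  shows "(1 + lam * (a + \<i> * \<gamma>)) * to_complex (resolvent (opA a \<gamma>) lam y) = to_complex y"
proof -
  let ?p = "1 + lam * (a + \<i> * \<gamma>)"
  have p: "?p \<noteq> 0" by (rule frb_multiplier_nonzero[OF assms])
  have f: "to_complex (x + lam *\<^sub>R opA a \<gamma> x) = ?p * to_complex x" for x
    by (simp add: algebra_simps)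
  have "inj (\<lambda>x. x + lam *\<^sub>R opA a \<gamma> x)"
    by (rule injI) (metis f p mult_left_cancel to_complex_eq_iff)
  moreover have "of_complex (to_complex y / ?p) + lam *\<^sub>R opA a \<gamma> (of_complex (to_complex y / ?p)) = y"
    unfolding to_complex_eq_iff[symmetric] f using p by simp
  \<comment> \<open>Injectivity together with an explicit preimage determines the value of
    \<open>inv\<close> at \<open>y\<close>.\<close>
  ultimately have "resolvent (opA a \<gamma>) lam y = of_complex (to_complex y / ?p)"
    unfolding resolvent_def by (rule inv_f_eq)
  then show ?thesis using p by simp
qed

text \<open>The roots enter only through their sum and product, so they can be swapped, and the root
  1 of the degenerate case can be inserted directly.\<close>

lemma to_complex_frb_rec:
  assumes "a \<ge> 0" "lam > 0" and p: "p = 1 + lam * (a + \<i> * \<gamma>)"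
    and r: "p * (r1 + r2) = 1 - 2 * \<i> * lam" "p * (r1 * r2) = - (\<i> * lam)"
  defines "z \<equiv> \<lambda>xm1 x0 n. to_complex (frb (opA a \<gamma>) rotJ lam xm1 x0 n)"
  shows "z xm1 x0 (Suc (Suc n)) = (r1 + r2) * z xm1 x0 (Suc n) - r1 * r2 * z xm1 x0 n"
proof -
  have "p \<noteq> 0" unfolding p by (rule frb_multiplier_nonzero[OF assms(1,2)])
  have "p * z xm1 x0 (Suc (Suc n)) = (1 - 2 * \<i> * lam) * z xm1 x0 (Suc n) + \<i> * lam * z xm1 x0 n"
    unfolding z_def p frb.simps to_complex_resolvent[OF assms(1,2)]
    by (simp add: algebra_simps)
  also have "\<dots> = p * (r1 + r2) * z xm1 x0 (Suc n) - p * (r1 * r2) * z xm1 x0 n"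
    unfolding r by simp
  also have "\<dots> = p * ((r1 + r2) * z xm1 x0 (Suc n) - r1 * r2 * z xm1 x0 n)"
    by (simp add: algebra_simps)
  finally show ?thesis using \<open>p \<noteq> 0\<close> by simp
qed

lemma tendsto_of_to_complex:
  assumes "(\<lambda>n. to_complex (x n)) \<longlonglongrightarrow> z"
  shows "x \<longlonglongrightarrow> of_complex z"
  using bounded_linear.tendsto[OF linear_conv_bounded_linear[THEN iffD1, OF linear_of_complex] assms]
  by simp

subsection \<open>Convergence and divergence\<close>

lemma frb_tendsto_0:
  assumes a: "a \<ge> 0" and nz: "\<not> (a = 0 \<and> \<gamma> = -1)"
    and lam: "0 < lam" "ereal lam < lambda_star a \<gamma>"
  shows "frb (opA a \<gamma>) rotJ lam xm1 x0 \<longlonglongrightarrow> 0"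
proof -
  define p where "p = 1 + lam * (a + \<i> * \<gamma>)"
  have p: "p \<noteq> 0" unfolding p_def by (rule frb_multiplier_nonzero[OF a lam(1)])
  obtain r1 r2 where r: "p * (r1 + r2) = 1 - 2 * \<i> * lam" "p * (r1 * r2) = - (\<i> * lam)"
    and D: "(cmod p)^2 * (1 - (cmod r1)\<^sup>2 * (cmod r2)\<^sup>2) = (1 + lam * a)\<^sup>2 + lam\<^sup>2 * \<gamma>\<^sup>2 - lam\<^sup>2"
    and P: "(cmod p)^4 * ((1 - (cmod r1)\<^sup>2) * (1 - (cmod r2)\<^sup>2) * (cmod (1 - cnj r1 * r2))\<^sup>2)
      = lam * poly (frb_cubic a \<gamma>) lam"
    using frb_charpoly_factor[OF p p_def] by metis
  have "(cmod p)^2 * (1 - (cmod r1)\<^sup>2 * (cmod r2)\<^sup>2) > 0"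
    unfolding D by (rule frb_gap_pos_below_lambda_star[OF a nz lam])
  then have 1: "(cmod r1)\<^sup>2 * (cmod r2)\<^sup>2 < 1" using p by (simp add: zero_less_mult_iff)
  have "(cmod p)^4 * ((1 - (cmod r1)\<^sup>2) * (1 - (cmod r2)\<^sup>2) * (cmod (1 - cnj r1 * r2))\<^sup>2) > 0"
    unfolding P using frb_cubic_pos_below_lambda_star[OF a nz lam] lam by simp
  then have 2: "(1 - (cmod r1)\<^sup>2) * (1 - (cmod r2)\<^sup>2) > 0"
    using p by (auto simp: zero_less_mult_iff not_less[symmetric])
  \<comment> \<open>By \<open>2\<close> the roots lie strictly on the same side of the unit circle;
    by \<open>1\<close> this cannot be the outside.\<close>
  have "(cmod r1)\<^sup>2 < 1 \<and> (cmod r2)\<^sup>2 < 1"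
    using 2 1 mult_mono[of 1 "(cmod r1)\<^sup>2" 1 "(cmod r2)\<^sup>2"] by (auto simp: zero_less_mult_iff)
  then have "cmod r1 < 1" "cmod r2 < 1" by (simp_all add: power_less_one_iff)
  then have "(\<lambda>n. to_complex (frb (opA a \<gamma>) rotJ lam xm1 x0 n)) \<longlonglongrightarrow> 0"
    using to_complex_frb_rec[OF a lam(1) p_def r, of xm1 x0] by (intro linear_recursion_tendsto_0)
  then show ?thesis
    using tendsto_of_to_complex linear_0[OF linear_of_complex] by fastforce
qed

text \<open>One root lies outside the unit circle and one inside. Initial pairs with no component
  along the outer root have to be set aside; they form the real subspace \<open>S\<close>.\<close>

lemma frb_diverges:
  assumes a: "a \<ge> 0" and lam: "ereal lam > lambda_star a \<gamma>"
  shows "\<exists>S :: ((real ^ 2) \<times> (real ^ 2)) set. subspace S \<and> S \<noteq> UNIV \<and>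
    (\<forall>xm1 x0. (xm1, x0) \<notin> S \<longrightarrow>
       filterlim (\<lambda>n. norm (frb (opA a \<gamma>) rotJ lam xm1 x0 n)) at_top sequentially)"
proof -
  note lam' = frb_cubic_neg_above_lambda_star[OF a lam]
  define p where "p = 1 + lam * (a + \<i> * \<gamma>)"
  have p: "p \<noteq> 0" unfolding p_def by (rule frb_multiplier_nonzero[OF a lam'(1)])
  obtain r1 r2 where r: "p * (r1 + r2) = 1 - 2 * \<i> * lam" "p * (r1 * r2) = - (\<i> * lam)"
    and P: "(cmod p)^4 * ((1 - (cmod r1)\<^sup>2) * (1 - (cmod r2)\<^sup>2) * (cmod (1 - cnj r1 * r2))\<^sup>2)
      = lam * poly (frb_cubic a \<gamma>) lam"
    using frb_charpoly_factor[OF p p_def] by metis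
  have "(cmod p)^4 * ((1 - (cmod r1)\<^sup>2) * (1 - (cmod r2)\<^sup>2) * (cmod (1 - cnj r1 * r2))\<^sup>2) < 0"
    unfolding P using lam' by (simp add: mult_pos_neg)
  then have "(1 - (cmod r1)\<^sup>2) * (1 - (cmod r2)\<^sup>2) < 0"
    by (auto simp: mult_less_0_iff not_less[symmetric])
  then have "cmod r1 > 1 \<and> cmod r2 < 1 \<or> cmod r2 > 1 \<and> cmod r1 < 1"
    using abs_square_le_1[of "cmod r1"] abs_square_le_1[of "cmod r2"]
    by (auto simp: mult_less_0_iff abs_square_less_1)
  then obtain R1 R2 where R: "cmod R1 > 1" "cmod R2 < 1"
    "p * (R1 + R2) = 1 - 2 * \<i> * lam" "p * (R1 * R2) = - (\<i> * lam)"
    using r by (metis add.commute mult.commute)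
  \<comment> \<open>For these pairs \<open>x0\<close> is \<open>R2\<close> times \<open>xm1\<close>,
    and the complex iterates are geometric with ratio \<open>R2\<close>.\<close>
  define S where "S = {x :: (real ^ 2) \<times> (real ^ 2). to_complex (snd x) = R2 * to_complex (fst x)}"
  have "subspace S"
    by (auto simp: subspace_def S_def algebra_simps)
  moreover have "(0, of_complex 1) \<notin> S" by (simp add: S_def)
  moreover have "filterlim (\<lambda>n. norm (frb (opA a \<gamma>) rotJ lam xm1 x0 n)) at_top sequentially"
    if "(xm1, x0) \<notin> S" for xm1 x0
  proof -
    have "filterlim (\<lambda>n. cmod (to_complex (frb (opA a \<gamma>) rotJ lam xm1 x0 n))) at_top sequentially"
      using to_complex_frb_rec[OF a lam'(1) p_def R(3,4), of xm1 x0] R(1,2)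
      by (rule linear_recursion_at_infinity) (use that in \<open>simp add: S_def\<close>)
    then show ?thesis by (simp add: norm_to_complex)
  qed
  ultimately show ?thesis by blast
qed

section \<open>The degenerate point \<open>(a, \<gamma>) = (0, -1)\<close>\<close>

lemma frb_charpoly_0_m1:
  fixes lam :: real
  shows "frb_charpoly 0 (-1) lam = [:-1, 1:] * [:\<i> * lam, 1 - \<i> * lam:]"
  by (simp add: frb_charpoly_def algebra_simps)

lemma cmod_one_minus_i: "cmod (1 - \<i> * lam) = sqrt (1 + lam\<^sup>2)" for lam :: real
  by (simp add: cmod_def)

lemma one_minus_i_nonzero: "1 - \<i> * complex_of_real lam \<noteq> 0"
  by (simp add: complex_eq_iff)

lemma degenerate_root_norm:
  fixes lam :: real
  assumes "lam > 0"
  defines "r \<equiv> - (\<i> * lam) / (1 - \<i> * lam)"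
  shows "cmod r = lam / sqrt (1 + lam\<^sup>2)" "cmod r < 1"
proof -
  show eq: "cmod r = lam / sqrt (1 + lam\<^sup>2)"
    using assms by (simp add: r_def norm_divide norm_mult cmod_one_minus_i)
  have "lam < sqrt (1 + lam\<^sup>2)" by (rule real_less_rsqrt) simp
  moreover have "0 < sqrt (1 + lam\<^sup>2)" using calculation assms(1) by linarith
  ultimately show "cmod r < 1" unfolding eq by (simp only: divide_less_eq_1_pos)
qed

text \<open>The cofactor of \<open>[:-1, 1:]\<close> takes the value 1 at 1, so the root is
  simple.\<close>

lemma order_1_frb_charpoly_0_m1: "order 1 (frb_charpoly 0 (-1) lam) = 1"
proof -
  let ?q = "[:\<i> * complex_of_real lam, 1 - \<i> * complex_of_real lam:]"
  have q: "poly ?q 1 \<noteq> 0" by simp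
  then have "?q \<noteq> 0" by (metis poly_0)
  then have "order 1 ([:-1, 1:] * ?q) = order 1 [:-1, 1::complex:] + order 1 ?q"
    by (intro order_mult no_zero_divisors) auto
  also have "\<dots> = 1"
    using order_0I[OF q] order_power_n_n[of "1::complex" 1] by simp
  finally show ?thesis unfolding frb_charpoly_0_m1 .
qed

lemma frb_charpoly_0_m1_roots:
  "{z. poly (frb_charpoly 0 (-1) lam) z = 0} = {1, - (\<i> * lam) / (1 - \<i> * lam)}"
proof -
  have "poly (frb_charpoly 0 (-1) lam) z = 0 \<longleftrightarrow> z = 1 \<or> z = - (\<i> * lam) / (1 - \<i> * lam)" for z
  proof -
    have "poly (frb_charpoly 0 (-1) lam) z = (z - 1) * (\<i> * lam + z * (1 - \<i> * lam))"
      unfolding frb_charpoly_0_m1 by (simp add: algebra_simps)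
    moreover have "\<i> * lam + z * (1 - \<i> * lam) = 0 \<longleftrightarrow> z = - (\<i> * lam) / (1 - \<i> * lam)"
      unfolding nonzero_eq_divide_eq[OF one_minus_i_nonzero] by (rule add_eq_0_iff)
    ultimately show ?thesis by simp
  qed
  then show ?thesis by auto
qed

text \<open>The existence of a limit suffices, since every point is a zero of \<open>A + B\<close>
  here. The roots 1 and \<open>r\<close> are checked through their sum and product.\<close>

lemma frb_convergent_degenerate:
  fixes lam :: real
  assumes "lam > 0"
  obtains z where "frb (opA 0 (-1)) rotJ lam xm1 x0 \<longlonglongrightarrow> z"
proof -
  define p where "p = 1 + lam * (complex_of_real 0 + \<i> * complex_of_real (-1))"
  define r where "r = - (\<i> * lam) / (1 - \<i> * lam)"
  have p: "p = 1 - \<i> * lam" by (simp add: p_def)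
  have "p * (1 + r) = 1 - 2 * \<i> * lam" "p * (1 * r) = - (\<i> * lam)"
    using one_minus_i_nonzero[of lam] by (simp_all add: r_def p field_simps)
  note rec = to_complex_frb_rec[OF order_refl assms p_def this]
  have "convergent (\<lambda>n. to_complex (frb (opA 0 (-1)) rotJ lam xm1 x0 n))"
    using rec[of xm1 x0] degenerate_root_norm(2)[OF assms]
    unfolding mult_1 r_def[symmetric] by (rule linear_recursion_convergent)
  then show ?thesis using that tendsto_of_to_complex unfolding convergent_def by blast
qed

theorem theorem4:
  shows
    "(\<forall>a \<gamma>. a \<ge> 0 \<longrightarrow>
        (frb_cubic a \<gamma> = 0 \<longleftrightarrow> a = 0 \<and> \<gamma> = -1) \<and>
        zer_sum (opA a \<gamma>) rotJ = (if a = 0 \<and> \<gamma> = -1 then UNIV else {0}) \<and>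
        (\<forall>lam. 0 < lam \<and> ereal lam < lambda_star a \<gamma> \<longrightarrow>
           (\<forall>xm1 x0. \<exists>z \<in> zer_sum (opA a \<gamma>) rotJ.
              frb (opA a \<gamma>) rotJ lam xm1 x0 \<longlonglongrightarrow> z)) \<and>
        (\<forall>lam. ereal lam > lambda_star a \<gamma> \<longrightarrow>
           (\<exists>S :: ((real ^ 2) \<times> (real ^ 2)) set. subspace S \<and> S \<noteq> UNIV \<and>
              (\<forall>xm1 x0. (xm1, x0) \<notin> S \<longrightarrow>
                 filterlim (\<lambda>n. norm (frb (opA a \<gamma>) rotJ lam xm1 x0 n)) at_top sequentially))))
     \<and> lambda_star 0 (-1) = \<infinity>
     \<and> (\<forall>lam>0.
          order 1 (frb_charpoly 0 (-1) lam) = 1 \<and>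
          (\<exists>r. {z. poly (frb_charpoly 0 (-1) lam) z = 0} = {1, r} \<and>
               cmod r = lam / sqrt (1 + lam^2) \<and> cmod r < 1) \<and>
          (\<forall>xm1 x0. \<exists>z \<in> zer_sum (opA 0 (-1)) rotJ.
             frb (opA 0 (-1)) rotJ lam xm1 x0 \<longlonglongrightarrow> z))
     \<and> lambda_star 0 1 = ereal (1 / 2)
     \<and> (\<forall>a \<gamma>. a \<ge> 0 \<longrightarrow> lambda_star 0 1 \<le> lambda_star a \<gamma>)"
proof -
  have star: "lambda_star 0 (-1) = \<infinity>"
    by (simp add: lambda_star_def frb_cubic_eq_0_iff)
  have conv: "\<exists>z \<in> zer_sum (opA a \<gamma>) rotJ. frb (opA a \<gamma>) rotJ lam xm1 x0 \<longlonglongrightarrow> z"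
    if "a \<ge> 0" "0 < lam" "ereal lam < lambda_star a \<gamma>" for a \<gamma> lam xm1 x0
  proof (cases "a = 0 \<and> \<gamma> = -1")
    case True
    then show ?thesis
      using frb_convergent_degenerate[OF \<open>0 < lam\<close>] by (metis UNIV_I zer_sum_opA_rotJ)
  next
    case False
    then show ?thesis using frb_tendsto_0[OF that(1) False that(2,3)] zer_sum_opA_rotJ by auto
  qed
  \<comment> \<open>The threshold is infinite at this point, so \<open>conv\<close> applies to every
    positive \<open>lam\<close>.\<close>
  have degenerate: "order 1 (frb_charpoly 0 (-1) lam) = 1 \<and>
      (\<exists>r. {z. poly (frb_charpoly 0 (-1) lam) z = 0} = {1, r} \<and>
           cmod r = lam / sqrt (1 + lam^2) \<and> cmod r < 1) \<and>
      (\<forall>xm1 x0. \<exists>z \<in> zer_sum (opA 0 (-1)) rotJ.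
         frb (opA 0 (-1)) rotJ lam xm1 x0 \<longlonglongrightarrow> z)" if "lam > 0" for lam
    using order_1_frb_charpoly_0_m1 frb_charpoly_0_m1_roots degenerate_root_norm[OF that]
      conv[OF order_refl that] star by auto
  show ?thesis
    using frb_cubic_eq_0_iff zer_sum_opA_rotJ conv frb_diverges star degenerate
      lambda_star_0_1 lambda_star_ge_half by (intro conjI allI impI) simp_all
qed

end
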